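(* There exists a simple $2$-$(55,10,4)$ design.
   Context: A $t$-$(v,k,\lambda)$ design consists of a $v$-element set $P$ of points together with a collection $B$ of $k$-element subsets of $P$ (called blocks) such that every $t$-element subset of $P$ is contained in exactly $\lambda$ blocks. The design is simple if $B$ is a set, i.e. contains no repeated blocks. *)

theory Defs
  imports Main "HOL-Library.Multiset"
begin

text \<open>The blocks form a finite multiset, so that a design may have repeated blocks.\<close>

definition is_design ::
  "nat \<Rightarrow> nat \<Rightarrow> nat \<Rightarrow> nat \<Rightarrow> 'a set \<Rightarrow> 'a set multiset \<Rightarrow> bool" where
  "is_design t v k l P B \<longleftrightarrow>
     finite P \<and> card P = v \<and>
     (\<forall>b \<in># B. b \<subseteq> P \<and> card b = k) \<and>
     (\<forall>T. T \<subseteq> P \<and> card T = t \<longrightarrow> size {#b \<in># B. T \<subseteq> b#} = l)"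

definition simple_blocks :: "'a set multiset \<Rightarrow> bool" where
  "simple_blocks B \<longleftrightarrow> (\<forall>b. count B b \<le> 1)"

end

theory Submission
  imports Defs
begin

text \<open>The design is a difference family over the nonabelian group of order 55, the semidirect
  product of the integers modulo 11 by the group of multipliers generated by 3: its blocks are
  the left translates of four base blocks. As the group acts regularly on itself, every pair of
  points can be moved to a pair containing the identity, so only the 24 blocks through the
  identity have to be inspected. The base blocks were found by computer search.\<close>

text \<open>The number \<open>11 b + a\<close>, with \<open>a < 11\<close> and \<open>b < 5\<close>, encodes the affine map
  \<open>z \<mapsto> 3^b z + a\<close> modulo 11; multiplication is composition.\<close>

definition amul :: "nat \<Rightarrow> nat \<Rightarrow> nat" where
  "amul x y = (x mod 11 + 3 ^ (x div 11) * (y mod 11)) mod 11 + 11 * ((x div 11 + y div 11) mod 5)"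

text \<open>The inverse of \<open>z \<mapsto> 3^b z + a\<close> is
  \<open>z \<mapsto> 3^(-b) z - 3^(-b) a\<close>. Here \<open>10\<close> stands for -1 modulo 11,
  and \<open>4 * b\<close> for -b modulo 5, the order of 3 modulo 11.\<close>

definition invm :: "nat \<Rightarrow> nat" where
  "invm x = (10 * 3 ^ (4 * (x div 11)) * (x mod 11)) mod 11 + 11 * ((4 * (x div 11)) mod 5)"

lemma amul_less: "amul x y < 55"
proof -
  have "(x mod 11 + 3 ^ (x div 11) * (y mod 11)) mod 11 < 11" "(x div 11 + y div 11) mod 5 < 5"
    by simp_all
  then show ?thesis
    unfolding amul_def by linarith
qed

lemma amul_mod: "amul x y mod 11 = (x mod 11 + 3 ^ (x div 11) * (y mod 11)) mod 11"
  by (simp add: amul_def)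

lemma amul_div: "amul x y div 11 = (x div 11 + y div 11) mod 5"
  by (simp add: amul_def)

text \<open>Since 3^5 = 243 = 22 * 11 + 1, exponents of 3 matter only modulo 5. This is what makes
  \<open>amul\<close>, which reduces the exponent, associative.\<close>

lemma power3_mod_11: "(3::nat) ^ (n mod 5) mod 11 = 3 ^ n mod 11"
proof -
  have "(3::nat) ^ n = (3 ^ 5) ^ (n div 5) * 3 ^ (n mod 5)"
    by (simp only: power_mult [symmetric] power_add [symmetric] mult_div_mod_eq)
  also have "\<dots> mod 11 = ((3 ^ 5) mod 11) ^ (n div 5) * 3 ^ (n mod 5) mod 11"
    by (metis mod_mult_left_eq power_mod)
  finally show ?thesis
    by simp
qed

lemma amul_assoc: "amul (amul x y) z = amul x (amul y z)"
proof -
  define a b c d e f where "a = x mod 11" and "b = x div 11" and "c = y mod 11"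
    and "d = y div 11" and "e = z mod 11" and "f = z div 11"
  have "((a + 3 ^ b * c) mod 11 + 3 ^ ((b + d) mod 5) * e) mod 11
      = (a + 3 ^ b * c + (3 ^ ((b + d) mod 5) mod 11) * e) mod 11"
    by (metis mod_add_eq mod_add_left_eq mod_mult_left_eq)
  also have "\<dots> = (a + 3 ^ b * c + 3 ^ (b + d) * e) mod 11"
    unfolding power3_mod_11 by (metis mod_add_right_eq mod_mult_left_eq)
  also have "\<dots> = (a + 3 ^ b * (c + 3 ^ d * e)) mod 11"
    by (simp add: algebra_simps power_add)
  also have "\<dots> = (a + 3 ^ b * ((c + 3 ^ d * e) mod 11)) mod 11"
    by (metis mod_add_right_eq mod_mult_right_eq)
  finally have "amul (amul x y) z mod 11 = amul x (amul y z) mod 11"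
    by (simp add: amul_mod amul_div a_def b_def c_def d_def e_def f_def)
  moreover have "amul (amul x y) z div 11 = amul x (amul y z) div 11"
    by (simp add: amul_div mod_simps add.assoc)
  ultimately show ?thesis
    by (metis mult_div_mod_eq)
qed

lemma group_laws:
  assumes "x < 55"
  shows "amul 0 x = x" "amul x 0 = x" "amul (invm x) x = 0" "amul x (invm x) = 0" "invm x < 55"
proof -
  have "list_all (\<lambda>x. amul 0 x = x \<and> amul x 0 = x \<and> amul (invm x) x = 0 \<and> amul x (invm x) = 0
    \<and> invm x < 55) [0..<55]"
    by (simp add: upt_conv_Cons amul_def invm_def)
  with assms show "amul 0 x = x" "amul x 0 = x" "amul (invm x) x = 0" "amul x (invm x) = 0"
    "invm x < 55"
    by (simp_all add: list_all_iff)
qed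

text \<open>The last two base blocks are each a union of two right cosets of the subgroup {0, 11,
  22, 33, 44}, which therefore fixes them under left translation. They have 11 distinct translates
  each, the first two have 55 each: 132 blocks in all.\<close>

definition base_blocks :: "nat list list" where
  "base_blocks =
    [[0, 1, 4, 5, 9, 20, 21, 23, 29, 39],
     [0, 16, 18, 26, 30, 33, 36, 41, 46, 54],
     [0, 1, 11, 14, 22, 31, 33, 38, 44, 48],
     [0, 2, 11, 17, 22, 29, 33, 43, 44, 52]]"

text \<open>Taking a set counts coinciding translates once, so simplicity is built in.\<close>

definition blocks :: "nat set set" where
  "blocks = (\<Union>D\<in>set base_blocks. (\<lambda>g. amul g ` set D) ` {..<55})"

text \<open>Sorting gives each block a canonical list, so that \<open>remdups\<close> merges equal
  blocks.\<close>

definition blocks_through_0 :: "nat list list" where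
  "blocks_through_0 = remdups [sort (map (amul (invm p)) D). D \<leftarrow> base_blocks, p \<leftarrow> D]"

lemma base_blocks_check:
  "\<forall>D\<in>set base_blocks. length D = 10 \<and> distinct D \<and> (\<forall>p\<in>set D. p < 55)"
  by code_simp

text \<open>The four base blocks contribute 10, 10, 2 and 2 lists; the stabilizers of order 5 reduce
  the last two counts from 10.\<close>

lemma blocks_through_0_explicit:
  "blocks_through_0 =
    [[0, 1, 4, 5, 9, 20, 21, 23, 29, 39],
     [0, 3, 4, 8, 10, 19, 20, 22, 28, 38],
     [0, 1, 5, 7, 8, 16, 17, 25, 30, 35],
     [0, 4, 6, 7, 10, 15, 16, 24, 29, 34],
     [0, 2, 3, 6, 7, 11, 12, 25, 31, 41],
     [0, 4, 12, 14, 32, 44, 45, 46, 50, 52],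
     [0, 7, 19, 21, 28, 46, 48, 51, 52, 53],
     [0, 8, 14, 33, 37, 39, 40, 42, 45, 51],
     [0, 3, 17, 34, 36, 40, 42, 43, 48, 54],
     [0, 23, 24, 26, 27, 32, 36, 38, 53, 54],
     [0, 16, 18, 26, 30, 33, 36, 41, 46, 54],
     [0, 8, 12, 18, 23, 24, 25, 42, 43, 46],
     [0, 3, 15, 21, 26, 27, 28, 34, 35, 49],
     [0, 9, 13, 17, 20, 23, 30, 35, 48, 49],
     [0, 2, 11, 15, 19, 25, 32, 37, 50, 51],
     [0, 5, 6, 13, 18, 22, 34, 41, 47, 50],
     [0, 1, 6, 13, 19, 28, 36, 40, 45, 53],
     [0, 5, 10, 12, 18, 27, 35, 39, 44, 52],
     [0, 2, 16, 26, 31, 39, 40, 47, 49, 51],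
     [0, 9, 14, 24, 29, 37, 38, 45, 47, 49],
     [0, 1, 11, 14, 22, 31, 33, 38, 44, 48],
     [0, 10, 13, 21, 30, 32, 37, 43, 47, 54],
     [0, 2, 11, 17, 22, 29, 33, 43, 44, 52],
     [0, 9, 15, 20, 27, 31, 41, 42, 50, 53]]"
  by (simp add: blocks_through_0_def base_blocks_def amul_def invm_def)

lemma distinct_blocks_through_0: "list_all distinct blocks_through_0"
  by (simp add: blocks_through_0_explicit)

lemma count_blocks_through_0:
  "list_all (\<lambda>d. d = 0 \<or> length (filter (\<lambda>b. d \<in> set b) blocks_through_0) = 4) [0..<55]"
  by (simp add: upt_conv_Cons blocks_through_0_explicit)

lemma finite_blocks: "finite blocks"
  by (simp add: blocks_def)

lemma blocks_closed: "b \<in> blocks \<Longrightarrow> amul h ` b \<in> blocks"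
  unfolding blocks_def by (force simp: image_image amul_assoc [symmetric] amul_less)

lemma amul_cancel_left:
  assumes "g < 55" "x < 55" "amul g x = amul g y" "y < 55"
  shows "x = y"
  by (metis assms group_laws(1,3) amul_assoc)

lemma block_subset_card:
  assumes "b \<in> blocks"
  shows "b \<subseteq> {..<55}" "card b = 10"
proof -
  obtain g D where g: "g < 55" and D: "D \<in> set base_blocks" and b: "b = amul g ` set D"
    using assms by (auto simp: blocks_def)
  show "b \<subseteq> {..<55}"
    using b amul_less by auto
  have "inj_on (amul g) (set D)"
    using D base_blocks_check g amul_cancel_left by (meson inj_onI)
  then show "card b = 10"
    using D base_blocks_check by (simp add: b card_image distinct_card)
qed

text \<open>A translate of \<open>D\<close> by \<open>g\<close> contains the identity exactly when
  \<open>amul g p = 0\<close> for some \<open>p\<close> in \<open>D\<close>, which forces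
  \<open>g = invm p\<close>.\<close>

lemma blocks_through_0_eq: "{b \<in> blocks. 0 \<in> b} = set ` set blocks_through_0"
proof (intro equalityI subsetI)
  fix b assume "b \<in> {b \<in> blocks. 0 \<in> b}"
  then obtain g D p where g: "g < 55" and D: "D \<in> set base_blocks" and b: "b = amul g ` set D"
    and p: "p \<in> set D" "amul g p = 0"
    by (force simp: blocks_def)
  have "p < 55"
    using D p base_blocks_check by blast
  have "g = amul g (amul p (invm p))"
    using g \<open>p < 55\<close> by (simp add: group_laws)
  also have "\<dots> = amul (amul g p) (invm p)"
    by (simp only: amul_assoc)
  also have "\<dots> = invm p"
    using p(2) \<open>p < 55\<close> by (simp add: group_laws)
  finally have "b = set (sort (map (amul (invm p)) D))"
    by (simp add: b)
  moreover have "sort (map (amul (invm p)) D) \<in> set blocks_through_0"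
    using D p(1) by (auto simp: blocks_through_0_def)
  ultimately show "b \<in> set ` set blocks_through_0"
    by blast
next
  fix b assume "b \<in> set ` set blocks_through_0"
  then obtain D p where D: "D \<in> set base_blocks" and p: "p \<in> set D"
    and b: "b = amul (invm p) ` set D"
    by (auto simp: blocks_through_0_def)
  have "p < 55"
    using D p base_blocks_check by blast
  then have "invm p < 55" "amul (invm p) p = 0"
    by (simp_all add: group_laws)
  then have "b \<in> blocks" "0 \<in> b"
    using D p b by (auto simp: blocks_def)
  then show "b \<in> {b \<in> blocks. 0 \<in> b}"
    by blast
qed

text \<open>A sorted list without repetitions is determined by its set, so counting lists counts
  blocks.\<close>

lemma inj_on_set_blocks_through_0: "inj_on set (set blocks_through_0)"
proof (rule inj_onI)
  fix b c
  assume bc: "b \<in> set blocks_through_0" "c \<in> set blocks_through_0" "set b = set c"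
  have "sorted b" "sorted c"
    using bc by (auto simp: blocks_through_0_def)
  then show "b = c"
    using bc distinct_blocks_through_0 by (simp add: list_all_iff sorted_distinct_set_unique)
qed

lemma card_blocks_through_0:
  assumes "d < 55" "d \<noteq> 0"
  shows "card {b \<in> blocks. {0, d} \<subseteq> b} = 4"
proof -
  have "{b \<in> blocks. {0, d} \<subseteq> b} = {b \<in> set ` set blocks_through_0. d \<in> b}"
    using blocks_through_0_eq by blast
  also have "\<dots> = set ` set (filter (\<lambda>b. d \<in> set b) blocks_through_0)"
    by auto
  also have "card \<dots> = card (set (filter (\<lambda>b. d \<in> set b) blocks_through_0))"
    by (intro card_image inj_on_subset [OF inj_on_set_blocks_through_0]) auto
  also have "\<dots> = length (filter (\<lambda>b. d \<in> set b) blocks_through_0)"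
    by (intro distinct_card distinct_filter) (simp add: blocks_through_0_def)
  also have "\<dots> = 4"
    using assms count_blocks_through_0 unfolding list_all_iff set_upt
    by (meson atLeastLessThan_iff zero_le)
  finally show ?thesis .
qed

lemma card_blocks_through_pair:
  assumes x: "x < 55" and y: "y < 55" and "x \<noteq> y"
  shows "card {b \<in> blocks. {x, y} \<subseteq> b} = 4"
proof -
  define d where "d = amul (invm x) y"
  have xd: "amul x d = y"
    by (metis d_def group_laws(1,4) amul_assoc x y)
  \<comment> \<open>If \<open>d\<close> were 0, then \<open>y = amul x 0 = x\<close>.\<close>
  have d: "d < 55" "d \<noteq> 0"
    using xd \<open>x \<noteq> y\<close> group_laws(2) [OF x] amul_less d_def by metis+
  \<comment> \<open>Multiplication by 0 fixes only numbers below 55, hence the restriction to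
    blocks.\<close>
  have cancel: "amul x ` amul (invm x) ` b = b" "amul (invm x) ` amul x ` b = b" if "b \<in> blocks" for b
  proof -
    have "amul 0 z = z" if "z \<in> b" for z
      using that \<open>b \<in> blocks\<close> block_subset_card(1) group_laws(1) by blast
    then show "amul x ` amul (invm x) ` b = b" "amul (invm x) ` amul x ` b = b"
      using x by (simp_all add: image_image amul_assoc [symmetric] group_laws)
  qed
  have "bij_betw ((`) (amul (invm x))) {b \<in> blocks. {x, y} \<subseteq> b} {b \<in> blocks. {0, d} \<subseteq> b}"
  proof (rule bij_betw_byWitness [where f' = "(`) (amul x)"])
    show "(`) (amul (invm x)) ` {b \<in> blocks. {x, y} \<subseteq> b} \<subseteq> {b \<in> blocks. {0, d} \<subseteq> b}"
    proof (intro image_subsetI CollectI conjI)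
      fix b assume b: "b \<in> {b \<in> blocks. {x, y} \<subseteq> b}"
      then show "amul (invm x) ` b \<in> blocks"
        by (simp add: blocks_closed)
      have "amul (invm x) ` {x, y} \<subseteq> amul (invm x) ` b"
        using b by (intro image_mono) simp
      then show "{0, d} \<subseteq> amul (invm x) ` b"
        by (simp add: d_def group_laws x)
    qed
    show "(`) (amul x) ` {b \<in> blocks. {0, d} \<subseteq> b} \<subseteq> {b \<in> blocks. {x, y} \<subseteq> b}"
    proof (intro image_subsetI CollectI conjI)
      fix b assume b: "b \<in> {b \<in> blocks. {0, d} \<subseteq> b}"
      then show "amul x ` b \<in> blocks"
        by (simp add: blocks_closed)
      have "amul x ` {0, d} \<subseteq> amul x ` b"
        using b by (intro image_mono) simp
      then show "{x, y} \<subseteq> amul x ` b"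
        by (simp add: xd group_laws x)
    qed
  qed (simp_all add: cancel)
  then have "card {b \<in> blocks. {x, y} \<subseteq> b} = card {b \<in> blocks. {0, d} \<subseteq> b}"
    by (rule bij_betw_same_card)
  then show ?thesis
    using card_blocks_through_0 [OF d] by simp
qed

theorem theorem1:
  "\<exists>(P :: nat set) (B :: nat set multiset). is_design 2 55 10 4 P B \<and> simple_blocks B"
proof (intro exI conjI)
  have "card {b \<in> blocks. T \<subseteq> b} = 4" if "T \<subseteq> {..<55}" "card T = 2" for T
    using that card_blocks_through_pair by (auto simp: card_2_iff)
  then show "is_design 2 55 10 4 {..<55} (mset_set blocks)"
    using block_subset_card by (simp add: is_design_def finite_blocks filter_mset_mset_set)
  show "simple_blocks (mset_set blocks)"
    by (simp add: simple_blocks_def count_mset_set')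
qed

end
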